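(* Let $\gamma>1$, $t_{\mathrm f}\in\mathbb{R}$ and $x_1^{t_{\mathrm f}}>1$. Let $f$ be the right-hand side of the Davis--Skodje model, $$f(x_1,x_2)=\begin{pmatrix}-x_1\\[2pt] -\gamma x_2+\dfrac{(\gamma-1)x_1+\gamma x_1^2}{(1+x_1)^2}\end{pmatrix},$$ let $J_f$ be the Jacobian matrix of $f$, and let $$\Lambda_{\mathrm s}=\Bigl\{(x_1,x_2)\in\mathbb{R}^2 \ \Big|\ x_2=\tfrac{x_1}{1+x_1}\Bigr\}.$$ For each $t_0<t_{\mathrm f}$ let $x^*=x^*_{t_0}$ be the optimal solution of the variational problem $$\min_{x(\cdot)}\int_{t_0}^{t_{\mathrm f}}\|J_f(x(t))\,f(x(t))\|_2^2\,\mathrm{d}t\quad\text{subject to}\quad \dot x(t)=f(x(t))\ \text{ on } [t_0,t_{\mathrm f}],\qquad x_1(t_{\mathrm f})=x_1^{t_{\mathrm f}}.$$ Then $$\lim_{t_0\to-\infty} d\bigl(x^*(t_{\mathrm f}),\Lambda_{\mathrm s}\bigr)=\lim_{t_0\to-\infty}\ \inf_{b\in\Lambda_{\mathrm s}}\|x^*(t_{\mathrm f})-b\|_2=0 .$$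
   Context: $\|\cdot\|_2$ is the Euclidean norm on $\mathbb{R}^2$. The minimization is over all solutions $x=(x_1,x_2):[t_0,t_{\mathrm f}]\to\mathbb{R}^2$ of the ODE whose first component has the prescribed value $x_1^{t_{\mathrm f}}$ at time $t_{\mathrm f}$; the second component at time $t_{\mathrm f}$ is free. The values $t_{\mathrm f}$, $x_1^{t_{\mathrm f}}$, $\gamma$ are held fixed as $t_0\to-\infty$. The set $\Lambda_{\mathrm s}$ is called the slow invariant manifold of the model. *)

theory Defs
  imports "HOL-Analysis.Analysis"
begin

(* In Isabelle x / 0 = 0, so this is total; the value on the line x1 = -1, where the
   model is undefined, is irrelevant: solutions with x1(tf) > 0 have x1 > 0 throughout. *)
definition davis_skodje :: "real \<Rightarrow> real^2 \<Rightarrow> real^2" where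
  "davis_skodje \<gamma> x = vector
     [- (x $ 1),
      - \<gamma> * x $ 2 + ((\<gamma> - 1) * x $ 1 + \<gamma> * (x $ 1)\<^sup>2) / (1 + x $ 1)\<^sup>2]"

(* The second conjunct removes (-1, 0), a point only because x / 0 = 0. *)
definition slow_manifold :: "(real^2) set" where
  "slow_manifold = {x. x $ 2 = x $ 1 / (1 + x $ 1) \<and> x $ 1 \<noteq> -1}"

definition feasible ::
    "(real^2 \<Rightarrow> real^2) \<Rightarrow> real \<Rightarrow> real \<Rightarrow> real \<Rightarrow> (real \<Rightarrow> real^2) \<Rightarrow> bool" where
  "feasible f t0 tf x1f x \<longleftrightarrow>
     (\<forall>t\<in>{t0..tf}. (x has_vector_derivative f (x t)) (at t within {t0..tf})) \<and>
     x tf $ 1 = x1f"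

definition cost :: "(real^2 \<Rightarrow> real^2) \<Rightarrow> real \<Rightarrow> real \<Rightarrow> (real \<Rightarrow> real^2) \<Rightarrow> real" where
  "cost f t0 tf x = integral {t0..tf} (\<lambda>t. (norm (jacobian f (at (x t)) *v f (x t)))\<^sup>2)"

(* Trajectories are total functions on the reals; their values outside [t0, tf] play no role. *)
definition optimal ::
    "(real^2 \<Rightarrow> real^2) \<Rightarrow> real \<Rightarrow> real \<Rightarrow> real \<Rightarrow> (real \<Rightarrow> real^2) \<Rightarrow> bool" where
  "optimal f t0 tf x1f x \<longleftrightarrow> is_arg_min (cost f t0 tf) (feasible f t0 tf x1f) x"

end

theory Submission
  imports Defs
begin

text \<open>
  Since \<open>x1\<close> decouples and the slow manifold is invariant, the feasible trajectories form
  a one-parameter family: \<open>x1(t) = x1f exp (tf - t)\<close> and \<open>x2 = x1 / (1 + x1) + c E\<close>, where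
  \<open>E(t) = exp (\<gamma> (tf - t))\<close> and \<open>c\<close> is the signed vertical distance to the manifold at the final
  time. Along a trajectory \<open>J f\<close> is the second time derivative of \<open>x\<close>, so the cost is a
  quadratic polynomial in \<open>c\<close>. Its minimizer is \<open>c = - (\<integral> k E) / (\<gamma>\<^sup>2 \<integral> E\<^sup>2)\<close>, where \<open>k\<close> is the
  second time derivative of \<open>x1 / (1 + x1)\<close>. As \<open>\<bar>k\<bar> \<le> 1\<close>, the numerator grows at most like
  \<open>exp (\<gamma> (tf - t0))\<close> and the denominator like the square of that.
\<close>

section \<open>Componentwise differentiation in the plane\<close>

lemma has_derivative_vector_2:
  fixes f g :: "'a::real_normed_vector \<Rightarrow> real"
  assumes "(f has_derivative f') F" "(g has_derivative g') F"
  shows "((\<lambda>x. vector [f x, g x] :: real^2) has_derivative (\<lambda>h. vector [f' h, g' h])) F"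
proof -
  have eq: "(vector [a, b] :: real^2) = a *\<^sub>R axis 1 1 + b *\<^sub>R axis 2 1" for a b
    by (simp add: vec_eq_iff forall_2 axis_def)
  show ?thesis
    unfolding eq using assms by (auto intro!: derivative_eq_intros)
qed

lemma has_vector_derivative_vector_2:
  fixes f g :: "real \<Rightarrow> real"
  assumes "(f has_real_derivative f') F" "(g has_real_derivative g') F"
  shows "((\<lambda>x. vector [f x, g x] :: real^2) has_vector_derivative vector [f', g']) F"
proof -
  have "(\<lambda>h. vector [f' * h, g' * h] :: real^2) = (\<lambda>h. h *\<^sub>R vector [f', g'])"
    by (simp add: fun_eq_iff vec_eq_iff forall_2)
  then show ?thesis
    using has_derivative_vector_2[of f "\<lambda>h. f' * h" F g "\<lambda>h. g' * h"] assms
    by (simp add: has_field_derivative_def has_vector_derivative_def)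
qed

lemma has_real_derivative_vec_nth:
  fixes x :: "real \<Rightarrow> real^'n"
  assumes "(x has_vector_derivative x') F"
  shows "((\<lambda>t. x t $ i) has_real_derivative x' $ i) F"
  using bounded_linear.has_vector_derivative[OF bounded_linear_vec_nth assms, of i]
  by (simp add: has_real_derivative_iff_has_vector_derivative)

section \<open>The Jacobian of the model\<close>

text \<open>The nonlinearity equals \<open>\<gamma> * s / (1 + s) - s / (1 + s)\<^sup>2\<close>; the
  two terms of the coefficient of \<open>v $ 1\<close> are the derivatives of these summands. Kept
  apart, they cancel easily when the Jacobian is applied to the vector field.\<close>

lemma jacobian_davis_skodje_mult:
  fixes y v :: "real^2"
  assumes "y $ 1 > 0"
  shows "jacobian (davis_skodje \<gamma>) (at y) *v v =
    vector [- (v $ 1),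
      - \<gamma> * v $ 2 + (\<gamma> / (1 + y $ 1)\<^sup>2 - (1 - y $ 1) / (1 + y $ 1) ^ 3) * v $ 1]"
    (is "_ = ?f' v")
proof -
  let ?q = "\<lambda>s::real. ((\<gamma> - 1) * s + \<gamma> * s\<^sup>2) / (1 + s)\<^sup>2"
  let ?q' = "\<gamma> / (1 + y $ 1)\<^sup>2 - (1 - y $ 1) / (1 + y $ 1) ^ 3"
  have "(?q has_real_derivative ?q') (at (y $ 1))"
  proof -
    have nz: "1 + y $ 1 \<noteq> 0" using assms by simp
    have "(?q has_real_derivative
        (((\<gamma> - 1) + \<gamma> * (2 * y $ 1)) * (1 + y $ 1)\<^sup>2
          - ((\<gamma> - 1) * y $ 1 + \<gamma> * (y $ 1)\<^sup>2) * (2 * (1 + y $ 1)))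
        / ((1 + y $ 1)\<^sup>2 * (1 + y $ 1)\<^sup>2)) (at (y $ 1))"
      using nz by (auto intro!: derivative_eq_intros)
    also have "(((\<gamma> - 1) + \<gamma> * (2 * y $ 1)) * (1 + y $ 1)\<^sup>2
          - ((\<gamma> - 1) * y $ 1 + \<gamma> * (y $ 1)\<^sup>2) * (2 * (1 + y $ 1)))
        / ((1 + y $ 1)\<^sup>2 * (1 + y $ 1)\<^sup>2) = ?q'"
    proof -
      \<comment> \<open>In terms of \<open>w\<close> the denominators are monomials, so that powers
        cancel directly.\<close>
      define w where "w = 1 + y $ 1"
      have y: "y $ 1 = w - 1" and "w \<noteq> 0" using nz by (auto simp: w_def)
      have "((\<gamma> - 1) + \<gamma> * (2 * (w - 1))) * w\<^sup>2 - ((\<gamma> - 1) * (w - 1) + \<gamma> * (w - 1)\<^sup>2) * (2 * w)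
          = w * (\<gamma> * w - (2 - w))"
        by (simp add: power2_eq_square algebra_simps)
      moreover have "w * (\<gamma> * w - (2 - w)) / (w\<^sup>2 * w\<^sup>2) = \<gamma> / w\<^sup>2 - (2 - w) / w ^ 3"
        using \<open>w \<noteq> 0\<close> by (simp add: power2_eq_square power3_eq_cube diff_divide_distrib right_diff_distrib)
      ultimately show ?thesis
        unfolding y by simp
    qed
    finally show ?thesis .
  qed
  then have "(?q has_derivative (\<lambda>h. ?q' * h)) (at (y $ 1))"
    by (simp add: has_field_derivative_def)
  from has_derivative_compose[OF bounded_linear_imp_has_derivative[OF bounded_linear_vec_nth] this]
  have "((\<lambda>x. ?q (x $ 1)) has_derivative (\<lambda>h. ?q' * h $ 1)) (at y)" .
  then have "(davis_skodje \<gamma> has_derivative ?f') (at y)"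
    unfolding davis_skodje_def
    by (intro has_derivative_vector_2 has_derivative_add has_derivative_minus
        has_derivative_mult_right bounded_linear_imp_has_derivative bounded_linear_vec_nth)
  from has_derivative_linear[OF this] frechet_derivative_at[OF this] show ?thesis
    using matrix_works[of ?f' v] by (simp add: jacobian_def linear_matrix_vector_mul_eq)
qed

section \<open>Explicit solutions and their uniqueness\<close>

text \<open>Both exponentials are 1 at \<open>tf\<close>, so the family is parametrised by final
  data and does not depend on \<open>t0\<close>.\<close>

definition ds_trajectory :: "real \<Rightarrow> real \<Rightarrow> real \<Rightarrow> real \<Rightarrow> real \<Rightarrow> real^2" where
  "ds_trajectory \<gamma> tf x1f c t = vector
     [x1f * exp (tf - t),
      x1f * exp (tf - t) / (1 + x1f * exp (tf - t)) + c * exp (\<gamma> * (tf - t))]"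

text \<open>The second time derivative of \<open>a / (1 + a)\<close> when \<open>a' = - a\<close>.\<close>
definition manifold_accel :: "real \<Rightarrow> real" where
  "manifold_accel a = a * (1 - a) / (1 + a) ^ 3"

text \<open>Crude, but uniform in \<open>a\<close>, which is unbounded along trajectories as
  \<open>t0\<close> decreases. It combines \<open>\<bar>1 - a\<bar> \<le> 1 + a\<close> with
  \<open>a \<le> 1 + a \<le> (1 + a)\<^sup>2\<close>.\<close>

lemma abs_manifold_accel_le:
  assumes "a > 0"
  shows "\<bar>manifold_accel a\<bar> \<le> 1"
proof -
  have "\<bar>a * (1 - a)\<bar> \<le> a * (1 + a)"
    using assms by (simp add: abs_mult)
  also have "\<dots> \<le> (1 + a) * (1 + a)\<^sup>2"
    using assms by (intro mult_mono) (auto simp: power2_eq_square)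
  finally show ?thesis
    using assms by (simp add: manifold_accel_def abs_mult power3_eq_cube power2_eq_square)
qed

text \<open>For \<open>c = 0\<close> this is the invariance of the slow manifold. The field is
  affine in the second coordinate with slope \<open>- \<gamma>\<close>, so multiples of the decaying
  exponential may be added.\<close>

lemma has_vector_derivative_ds_trajectory:
  assumes "x1f > 0"
  shows "(ds_trajectory \<gamma> tf x1f c has_vector_derivative
      davis_skodje \<gamma> (ds_trajectory \<gamma> tf x1f c t)) (at t within S)"
proof -
  define a where "a = x1f * exp (tf - t)"
  have a: "a > 0" using assms by (simp add: a_def)
  have d1: "((\<lambda>t. x1f * exp (tf - t)) has_real_derivative - a) (at t within S)"
    unfolding a_def by (auto intro!: derivative_eq_intros)
  have "((\<lambda>t. x1f * exp (tf - t) / (1 + x1f * exp (tf - t)) + c * exp (\<gamma> * (tf - t)))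
      has_real_derivative
      ((- a) * (1 + a) - a * (- a)) / ((1 + a) * (1 + a))
      + c * (- \<gamma> * exp (\<gamma> * (tf - t)))) (at t within S)"
    using a unfolding a_def by (auto intro!: derivative_eq_intros)
  also have "((- a) * (1 + a) - a * (- a)) / ((1 + a) * (1 + a)) + c * (- \<gamma> * exp (\<gamma> * (tf - t)))
      = - \<gamma> * (a / (1 + a) + c * exp (\<gamma> * (tf - t))) + ((\<gamma> - 1) * a + \<gamma> * a\<^sup>2) / (1 + a)\<^sup>2"
    using a by (simp add: divide_simps) (simp add: power2_eq_square algebra_simps)
  finally show ?thesis
    using has_vector_derivative_vector_2[OF d1]
    unfolding ds_trajectory_def davis_skodje_def a_def by simp
qed

lemma feasible_ds_trajectory:
  assumes "x1f > 0"
  shows "feasible (davis_skodje \<gamma>) t0 tf x1f (ds_trajectory \<gamma> tf x1f c)"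
  using has_vector_derivative_ds_trajectory[OF assms]
  by (auto simp: feasible_def) (simp add: ds_trajectory_def)

text \<open>The integrating factor \<open>exp (r * t)\<close> makes the product constant. The
  constant is read off at the right endpoint, where the problem prescribes data.\<close>

lemma eq_exp_of_linear_ode:
  fixes u :: "real \<Rightarrow> real"
  assumes "\<And>t. t \<in> {a..b} \<Longrightarrow> (u has_real_derivative - r * u t) (at t within {a..b})"
    and t: "t \<in> {a..b}"
  shows "u t = u b * exp (r * (b - t))"
proof -
  have "((\<lambda>t. u t * exp (r * t)) has_real_derivative 0) (at s within {a..b})"
    if "s \<in> {a..b}" for s
    using assms(1)[OF that]
    by (auto intro!: derivative_eq_intros simp: algebra_simps)
  then obtain k where k: "\<And>s. s \<in> {a..b} \<Longrightarrow> u s * exp (r * s) = k"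
    using has_field_derivative_zero_constant[of "{a..b}" "\<lambda>t. u t * exp (r * t)"] by auto
  have "u t * exp (r * t) = u b * exp (r * b)"
    using k[OF t] k[of b] t by simp
  then show ?thesis
    by (simp add: right_diff_distrib exp_diff field_simps)
qed

lemma feasible_imp_ds_trajectory:
  assumes feas: "feasible (davis_skodje \<gamma>) t0 tf x1f x" and "x1f > 0" and t: "t \<in> {t0..tf}"
  shows "x t = ds_trajectory \<gamma> tf x1f (x tf $ 2 - x1f / (1 + x1f)) t"
proof -
  let ?z = "ds_trajectory \<gamma> tf x1f (x tf $ 2 - x1f / (1 + x1f))"
  have x: "(x has_vector_derivative davis_skodje \<gamma> (x t)) (at t within {t0..tf})"
    if "t \<in> {t0..tf}" for t
    using feas that by (simp add: feasible_def)
  have z: "(?z has_vector_derivative davis_skodje \<gamma> (?z t)) (at t within {t0..tf})" for t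
    using has_vector_derivative_ds_trajectory[OF \<open>x1f > 0\<close>] .
  have xf: "x tf $ 1 = x1f"
    using feas by (simp add: feasible_def)
  have x1: "x t $ 1 = ?z t $ 1" if "t \<in> {t0..tf}" for t
  proof -
    have "x t $ 1 = x tf $ 1 * exp (1 * (tf - t))"
      using has_real_derivative_vec_nth[OF x, of _ 1] that
      by (intro eq_exp_of_linear_ode[of t0 tf "\<lambda>t. x t $ 1"]) (simp_all add: davis_skodje_def)
    then show ?thesis
      by (simp add: xf ds_trajectory_def)
  qed
  \<comment> \<open>The first components agree, so the nonlinear terms cancel and the difference
    solves a linear equation. Its final value is 0 by the choice of \<open>c\<close>.\<close>
  have "((\<lambda>t. x t $ 2 - ?z t $ 2) has_real_derivative - \<gamma> * (x t $ 2 - ?z t $ 2))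
      (at t within {t0..tf})" if "t \<in> {t0..tf}" for t
    using DERIV_diff[OF has_real_derivative_vec_nth[OF x[OF that], of 2]
        has_real_derivative_vec_nth[OF z, of 2]]
    by (simp add: davis_skodje_def x1[OF that] algebra_simps)
  from eq_exp_of_linear_ode[OF this t]
  have "x t $ 2 = ?z t $ 2"
    by (simp add: ds_trajectory_def)
  with x1[OF t] show ?thesis
    by (simp add: vec_eq_iff forall_2)
qed

section \<open>The cost as a quadratic polynomial in the offset\<close>

text \<open>The two squares are those of the components of the acceleration: \<open>a'' = a\<close>
  for the first, and the acceleration on the manifold plus \<open>c\<close> times the second
  derivative of the exponential for the other.\<close>

lemma norm_jacobian_ds_trajectory:
  assumes "x1f > 0"
  shows "(norm (jacobian (davis_skodje \<gamma>) (at (ds_trajectory \<gamma> tf x1f c t))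
            *v davis_skodje \<gamma> (ds_trajectory \<gamma> tf x1f c t)))\<^sup>2
      = (x1f * exp (tf - t))\<^sup>2
        + (manifold_accel (x1f * exp (tf - t)) + c * (\<gamma>\<^sup>2 * exp (\<gamma> * (tf - t))))\<^sup>2"
proof -
  define a E where "a = x1f * exp (tf - t)" and "E = exp (\<gamma> * (tf - t))"
  have a: "a > 0" using assms by (simp add: a_def)
  define y where "y = ds_trajectory \<gamma> tf x1f c t"
  have y1: "y $ 1 = a" and y2: "y $ 2 = a / (1 + a) + c * E"
    by (simp_all add: y_def ds_trajectory_def a_def E_def)
  have "- \<gamma> * (- \<gamma> * (a / (1 + a) + c * E) + ((\<gamma> - 1) * a + \<gamma> * a\<^sup>2) / (1 + a)\<^sup>2)
       + (\<gamma> / (1 + a)\<^sup>2 - (1 - a) / (1 + a) ^ 3) * (- a)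
       = manifold_accel a + c * (\<gamma>\<^sup>2 * E)"
  proof -
    \<comment> \<open>In this split form the terms in \<open>a / (1 + a)\<close> and in
      \<open>\<gamma> * a / (1 + a)\<^sup>2\<close> cancel.\<close>
    have "((\<gamma> - 1) * a + \<gamma> * a\<^sup>2) / (1 + a)\<^sup>2 = \<gamma> * (a / (1 + a)) - a / (1 + a)\<^sup>2"
      using a by (simp add: divide_simps) (simp add: power2_eq_square algebra_simps)
    then show ?thesis
      by (simp add: manifold_accel_def power2_eq_square[of \<gamma>] diff_divide_distrib algebra_simps)
  qed
  then have "jacobian (davis_skodje \<gamma>) (at y) *v davis_skodje \<gamma> y
      = vector [a, manifold_accel a + c * (\<gamma>\<^sup>2 * E)]"
    using a by (subst jacobian_davis_skodje_mult) (simp_all add: y1 y2 davis_skodje_def)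
  then show ?thesis
    unfolding y_def[symmetric] a_def[symmetric] E_def[symmetric]
    by (simp add: norm_vec_def L2_set_def sum_2)
qed

text \<open>Half the coefficient of \<open>c\<close> in the cost, so that the vertex is
  \<open>- lin_coeff / quad_coeff\<close>.\<close>

definition lin_coeff :: "real \<Rightarrow> real \<Rightarrow> real \<Rightarrow> real \<Rightarrow> real" where
  "lin_coeff \<gamma> t0 tf x1f =
     integral {t0..tf} (\<lambda>t. manifold_accel (x1f * exp (tf - t)) * (\<gamma>\<^sup>2 * exp (\<gamma> * (tf - t))))"

definition quad_coeff :: "real \<Rightarrow> real \<Rightarrow> real \<Rightarrow> real" where
  "quad_coeff \<gamma> t0 tf = integral {t0..tf} (\<lambda>t. (\<gamma>\<^sup>2 * exp (\<gamma> * (tf - t)))\<^sup>2)"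

lemma continuous_on_manifold_accel:
  assumes "x1f > 0"
  shows "continuous_on S (\<lambda>t. manifold_accel (x1f * exp (tf - t)))"
proof -
  have "(1 + x1f * exp (tf - t)) ^ 3 \<noteq> 0" for t
    using assms by (simp add: add_pos_pos less_imp_neq[symmetric])
  then show ?thesis
    unfolding manifold_accel_def by (intro continuous_intros) blast
qed

lemma cost_ds_trajectory:
  assumes "x1f > 0"
  shows "cost (davis_skodje \<gamma>) t0 tf (ds_trajectory \<gamma> tf x1f c)
      = integral {t0..tf} (\<lambda>t. (x1f * exp (tf - t))\<^sup>2 + (manifold_accel (x1f * exp (tf - t)))\<^sup>2)
        + 2 * c * lin_coeff \<gamma> t0 tf x1f + c\<^sup>2 * quad_coeff \<gamma> t0 tf"
proof -
  let ?k = "\<lambda>t. manifold_accel (x1f * exp (tf - t))" and ?E = "\<lambda>t. \<gamma>\<^sup>2 * exp (\<gamma> * (tf - t))"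
  have int: "(\<lambda>t. (x1f * exp (tf - t))\<^sup>2 + (?k t)\<^sup>2) integrable_on {t0..tf}"
    "(\<lambda>t. (2 * c) * (?k t * ?E t)) integrable_on {t0..tf}"
    "(\<lambda>t. c\<^sup>2 * (?E t)\<^sup>2) integrable_on {t0..tf}"
    by (intro integrable_continuous_interval continuous_intros
        continuous_on_manifold_accel[OF assms])+
  have "cost (davis_skodje \<gamma>) t0 tf (ds_trajectory \<gamma> tf x1f c)
      = integral {t0..tf} (\<lambda>t. ((x1f * exp (tf - t))\<^sup>2 + (?k t)\<^sup>2) + (2 * c) * (?k t * ?E t)
          + c\<^sup>2 * (?E t)\<^sup>2)"
    unfolding cost_def norm_jacobian_ds_trajectory[OF assms]
    by (simp add: power2_eq_square algebra_simps)
  also have "\<dots> = integral {t0..tf} (\<lambda>t. (x1f * exp (tf - t))\<^sup>2 + (?k t)\<^sup>2)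
      + integral {t0..tf} (\<lambda>t. (2 * c) * (?k t * ?E t)) + integral {t0..tf} (\<lambda>t. c\<^sup>2 * (?E t)\<^sup>2)"
    unfolding integral_add[OF integrable_add[OF int(1,2)] int(3)] integral_add[OF int(1,2)] ..
  finally show ?thesis
    by (simp add: lin_coeff_def quad_coeff_def)
qed

section \<open>Size of the coefficients and of the vertex\<close>

lemma integral_exp_to_final:
  fixes r :: real
  assumes "r > 0" "t0 \<le> tf"
  shows "integral {t0..tf} (\<lambda>t. exp (r * (tf - t))) = (exp (r * (tf - t0)) - 1) / r"
proof -
  have "((\<lambda>t. exp (r * (tf - t))) has_integral
      (- exp (r * (tf - tf)) / r - - exp (r * (tf - t0)) / r)) {t0..tf}"
    using assms
    by (intro fundamental_theorem_of_calculus)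
       (auto intro!: derivative_eq_intros
         simp flip: has_real_derivative_iff_has_vector_derivative)
  then show ?thesis
    by (simp add: integral_unique diff_divide_distrib)
qed

text \<open>The square of the exponential is kept visible in order to factor
  \<open>e\<^sup>2 - 1\<close> later.\<close>

lemma quad_coeff_eq:
  assumes "\<gamma> > 0" "t0 \<le> tf"
  shows "quad_coeff \<gamma> t0 tf = \<gamma> ^ 3 * ((exp (\<gamma> * (tf - t0)))\<^sup>2 - 1) / 2"
proof -
  have "(\<gamma>\<^sup>2 * exp (\<gamma> * (tf - t)))\<^sup>2 = \<gamma> ^ 4 * exp ((2 * \<gamma>) * (tf - t))" for t
    by (simp add: power_mult_distrib algebra_simps flip: exp_double)
  then have "quad_coeff \<gamma> t0 tf = \<gamma> ^ 4 * ((exp ((2 * \<gamma>) * (tf - t0)) - 1) / (2 * \<gamma>))"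
    using assms integral_exp_to_final[of "2 * \<gamma>" t0 tf] by (simp add: quad_coeff_def)
  also have "exp ((2 * \<gamma>) * (tf - t0)) = (exp (\<gamma> * (tf - t0)))\<^sup>2"
    by (simp add: algebra_simps flip: exp_double)
  also have "\<gamma> ^ 4 * ((s - 1) / (2 * \<gamma>)) = \<gamma> ^ 3 * (s - 1) / 2" for s
    using assms by (simp add: power_numeral_reduce)
  finally show ?thesis .
qed

lemma quad_coeff_pos:
  assumes "\<gamma> > 0" "t0 < tf"
  shows "quad_coeff \<gamma> t0 tf > 0"
  using assms by (simp add: quad_coeff_eq one_less_power)

text \<open>The factor \<open>manifold_accel\<close> is bounded by 1. The \<open>- 1\<close> is
  retained because it forms a factor that \<open>quad_coeff\<close> shares.\<close>

lemma abs_lin_coeff_le: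
  assumes "\<gamma> > 0" "t0 \<le> tf" "x1f > 0"
  shows "\<bar>lin_coeff \<gamma> t0 tf x1f\<bar> \<le> \<gamma> * (exp (\<gamma> * (tf - t0)) - 1)"
proof -
  have "norm (lin_coeff \<gamma> t0 tf x1f) \<le> integral {t0..tf} (\<lambda>t. \<gamma>\<^sup>2 * exp (\<gamma> * (tf - t)))"
    unfolding lin_coeff_def
  proof (rule integral_norm_bound_integral)
    show "(\<lambda>t. manifold_accel (x1f * exp (tf - t)) * (\<gamma>\<^sup>2 * exp (\<gamma> * (tf - t))))
        integrable_on {t0..tf}"
      using assms by (intro integrable_continuous_interval continuous_intros
          continuous_on_manifold_accel)
    show "(\<lambda>t. \<gamma>\<^sup>2 * exp (\<gamma> * (tf - t))) integrable_on {t0..tf}"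
      by (intro integrable_continuous_interval continuous_intros)
    show "norm (manifold_accel (x1f * exp (tf - t)) * (\<gamma>\<^sup>2 * exp (\<gamma> * (tf - t))))
        \<le> \<gamma>\<^sup>2 * exp (\<gamma> * (tf - t))" for t
      using abs_manifold_accel_le[of "x1f * exp (tf - t)"] assms
      by (simp add: abs_mult mult_left_le_one_le)
  qed
  then show ?thesis
    using assms by (simp add: integral_exp_to_final power2_eq_square)
qed

lemma abs_vertex_le:
  assumes "\<gamma> > 0" "t0 < tf" "x1f > 0"
  shows "\<bar>lin_coeff \<gamma> t0 tf x1f / quad_coeff \<gamma> t0 tf\<bar> \<le> 2 / \<gamma>\<^sup>2 * exp (- (\<gamma> * (tf - t0)))"
proof -
  define e where "e = exp (\<gamma> * (tf - t0))"
  have e: "e > 1" using assms by (simp add: e_def)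
  have "\<bar>lin_coeff \<gamma> t0 tf x1f / quad_coeff \<gamma> t0 tf\<bar>
      \<le> \<gamma> * (e - 1) / quad_coeff \<gamma> t0 tf"
    using abs_lin_coeff_le[of \<gamma> t0 tf x1f] quad_coeff_pos[of \<gamma> t0 tf] assms
    by (simp add: abs_divide divide_right_mono e_def)
  also have "\<dots> = 2 / \<gamma>\<^sup>2 * (1 / (e + 1))"
  proof -
    \<comment> \<open>Difference of squares: the first factor is exactly the bound on
      \<open>lin_coeff\<close>.\<close>
    have "quad_coeff \<gamma> t0 tf = (\<gamma> * (e - 1)) * (\<gamma>\<^sup>2 * (e + 1) / 2)"
      using assms by (simp add: quad_coeff_eq flip: e_def)
        (simp add: power2_eq_square power3_eq_cube algebra_simps)
    then show ?thesis
      using assms e quad_coeff_pos[of \<gamma> t0 tf] by (simp add: divide_simps)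
  qed
  also have "\<dots> \<le> 2 / \<gamma>\<^sup>2 * (1 / e)"
    using e by (intro mult_left_mono divide_left_mono) auto
  finally show ?thesis
    by (simp add: e_def exp_minus inverse_eq_divide)
qed

section \<open>Characterisation of the minimizers\<close>

lemma quadratic_minus_vertex:
  fixes A B D c :: real
  assumes "D > 0"
  shows "A + 2 * c * B + c\<^sup>2 * D - (A + 2 * (- B / D) * B + (- B / D)\<^sup>2 * D) = D * (c + B / D)\<^sup>2"
  using assms by (simp add: power2_eq_square field_simps)

text \<open>Completing the square shows that a feasible trajectory exceeds the cost at the vertex by
  \<open>D * (c x - m)\<^sup>2\<close> with \<open>D > 0\<close>. The trajectory at the vertex is
  itself feasible, so the minimum is attained exactly at offset \<open>m\<close>.\<close>

lemma optimal_davis_skodje_iff: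
  assumes "\<gamma> > 0" "t0 < tf" "x1f > 0"
  shows "optimal (davis_skodje \<gamma>) t0 tf x1f x \<longleftrightarrow>
      feasible (davis_skodje \<gamma>) t0 tf x1f x \<and>
      x tf $ 2 - x1f / (1 + x1f) = - lin_coeff \<gamma> t0 tf x1f / quad_coeff \<gamma> t0 tf"
proof -
  let ?feas = "feasible (davis_skodje \<gamma>) t0 tf x1f"
  let ?J = "cost (davis_skodje \<gamma>) t0 tf" and ?z = "ds_trajectory \<gamma> tf x1f"
  define c where "c x = x tf $ 2 - x1f / (1 + x1f)" for x :: "real \<Rightarrow> real^2"
  define D where "D = quad_coeff \<gamma> t0 tf"
  define m where "m = - lin_coeff \<gamma> t0 tf x1f / D"
  have D: "D > 0" using quad_coeff_pos assms by (simp add: D_def)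
  have J: "?J x = ?J (?z m) + D * (c x - m)\<^sup>2" if "?feas x" for x
  proof -
    have "?J x = ?J (?z (c x))"
      \<comment> \<open>The trajectories are only known to agree on \<open>{t0..tf}\<close>; this
        suffices, as the integrand depends on \<open>x\<close> only through
        \<open>x t\<close>.\<close>
      unfolding cost_def c_def
      by (intro integral_cong) (simp add: feasible_imp_ds_trajectory[OF that assms(3), symmetric])
    moreover have "?J (?z (c x)) - ?J (?z m) = D * (c x - m)\<^sup>2"
      unfolding cost_ds_trajectory[OF assms(3)] D_def[symmetric] m_def
      by (subst quadratic_minus_vertex[OF D]) simp
    ultimately show ?thesis by simp
  qed
  have "(\<nexists>y. ?feas y \<and> ?J y < ?J x) \<longleftrightarrow> c x = m" if x: "?feas x"
  proof
    assume "\<nexists>y. ?feas y \<and> ?J y < ?J x"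
    then have "\<not> ?J (?z m) < ?J x"
      using feasible_ds_trajectory[OF assms(3)] by blast
    then have "(c x - m)\<^sup>2 \<le> 0"
      using D by (simp add: J[OF x] not_less mult_le_0_iff)
    then show "c x = m" by simp
  next
    assume "c x = m"
    then have "?J x \<le> ?J y" if "?feas y" for y
      using D by (simp add: J[OF x] J[OF that])
    then show "\<nexists>y. ?feas y \<and> ?J y < ?J x"
      by (auto simp: not_less)
  qed
  then show ?thesis
    unfolding optimal_def is_arg_min_def c_def D_def m_def by blast
qed

section \<open>Distance to the slow manifold and the limit\<close>

text \<open>The competitor is the point of the manifold vertically above or below \<open>p\<close>;
  it exists away from the pole.\<close>

lemma infdist_slow_manifold_le:
  fixes p :: "real^2"
  assumes "p $ 1 \<noteq> -1"
  shows "infdist p slow_manifold \<le> \<bar>p $ 2 - p $ 1 / (1 + p $ 1)\<bar>"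
proof -
  let ?b = "vector [p $ 1, p $ 1 / (1 + p $ 1)] :: real^2"
  have "infdist p slow_manifold \<le> dist p ?b"
    using assms by (intro infdist_le) (simp add: slow_manifold_def)
  also have "\<dots> = \<bar>p $ 2 - p $ 1 / (1 + p $ 1)\<bar>"
    by (simp add: dist_norm norm_vec_def L2_set_def sum_2)
  finally show ?thesis .
qed

text \<open>The first conjunct justifies speaking of the optimal solution: it exists and is unique
  on \<open>{t0..tf}\<close>. The second then covers every choice of optimal solutions.\<close>

theorem theorem3p2:
  fixes \<gamma> tf x1f :: real
  assumes "\<gamma> > 1" and "x1f > 1"
  shows "(\<forall>t0<tf. \<exists>x. optimal (davis_skodje \<gamma>) t0 tf x1f x \<and>
            (\<forall>y. optimal (davis_skodje \<gamma>) t0 tf x1f y \<longrightarrow> (\<forall>t\<in>{t0..tf}. y t = x t))) \<and>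
         (\<forall>xs :: real \<Rightarrow> real \<Rightarrow> real^2.
            (\<forall>t0<tf. optimal (davis_skodje \<gamma>) t0 tf x1f (xs t0)) \<longrightarrow>
            ((\<lambda>t0. infdist (xs t0 tf) slow_manifold) \<longlongrightarrow> 0) at_bot)"
proof (intro conjI allI impI)
  have pos: "\<gamma> > 0" "x1f > 0" using assms by auto
  fix t0 assume t0: "t0 < tf"
  note opt_iff = optimal_davis_skodje_iff[OF pos(1) t0 pos(2)]
  let ?x = "ds_trajectory \<gamma> tf x1f (- lin_coeff \<gamma> t0 tf x1f / quad_coeff \<gamma> t0 tf)"
  have "optimal (davis_skodje \<gamma>) t0 tf x1f ?x"
    unfolding opt_iff using feasible_ds_trajectory[OF pos(2)] by (simp add: ds_trajectory_def)
  moreover have "y t = ?x t"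
    if "optimal (davis_skodje \<gamma>) t0 tf x1f y" "t \<in> {t0..tf}" for y t
    using that feasible_imp_ds_trajectory[OF _ pos(2) that(2), of \<gamma> y] unfolding opt_iff by simp
  ultimately show "\<exists>x. optimal (davis_skodje \<gamma>) t0 tf x1f x \<and>
      (\<forall>y. optimal (davis_skodje \<gamma>) t0 tf x1f y \<longrightarrow> (\<forall>t\<in>{t0..tf}. y t = x t))"
    by blast
next
  have pos: "\<gamma> > 0" "x1f > 0" using assms by auto
  fix xs :: "real \<Rightarrow> real \<Rightarrow> real^2"
  assume opt: "\<forall>t0<tf. optimal (davis_skodje \<gamma>) t0 tf x1f (xs t0)"
  have bound: "infdist (xs t0 tf) slow_manifold \<le> 2 / \<gamma>\<^sup>2 * exp (- (\<gamma> * (tf - t0)))"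
    if t0: "t0 < tf" for t0
  proof -
    have "xs t0 tf $ 1 = x1f"
      "xs t0 tf $ 2 - x1f / (1 + x1f) = - lin_coeff \<gamma> t0 tf x1f / quad_coeff \<gamma> t0 tf"
      using opt t0 optimal_davis_skodje_iff[OF pos(1) t0 pos(2)] by (auto simp: feasible_def)
    then show ?thesis
      using infdist_slow_manifold_le[of "xs t0 tf"] abs_vertex_le[OF pos(1) t0 pos(2)] pos
      by simp
  qed
  have "LIM t0 at_bot. - (\<gamma> * (tf - t0)) :> at_bot"
    unfolding filterlim_at_bot eventually_at_bot_linorder
  proof
    fix Z
    show "\<exists>N. \<forall>t0\<le>N. - (\<gamma> * (tf - t0)) \<le> Z"
      \<comment> \<open>The witness solves \<open>- (\<gamma> * (tf - N)) = Z\<close>.\<close>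
      using pos by (intro exI[of _ "tf + Z / \<gamma>"]) (auto simp: field_simps)
  qed
  then have "((\<lambda>t0. exp (- (\<gamma> * (tf - t0)))) \<longlongrightarrow> 0) at_bot"
    by (rule filterlim_compose[OF exp_at_bot])
  then have "((\<lambda>t0. 2 / \<gamma>\<^sup>2 * exp (- (\<gamma> * (tf - t0)))) \<longlongrightarrow> 0) at_bot"
    by (rule tendsto_mult_right_zero)
  then show "((\<lambda>t0. infdist (xs t0 tf) slow_manifold) \<longlongrightarrow> 0) at_bot"
  proof (rule tendsto_sandwich[rotated 3, where f = "\<lambda>_. 0"])
    show "\<forall>\<^sub>F t0 in at_bot. infdist (xs t0 tf) slow_manifold \<le> 2 / \<gamma>\<^sup>2 * exp (- (\<gamma> * (tf - t0)))"
      \<comment> \<open>The bound holds for all \<open>t0\<close> below the threshold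
        \<open>tf\<close>.\<close>
      unfolding eventually_at_bot_dense using bound by blast
  qed (simp_all add: infdist_nonneg)
qed

end
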